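(* Let $N$ be a positive integer which is not a perfect square, let $p$ be an integer with $p^2<N$, let $q$ be a positive integer dividing $N-p^2$, and put $\alpha=\frac{\sqrt N+p}{q}$. Then the left-positive path (LPP) of $\alpha$ is an irrationality path, i.e. there exist indices $n<m$ with $x_n=x_m$, where $(x_n)_{n\ge 0}$ is the sequence of numbers in the LPP of $\alpha$; and so $\alpha$ is irrational.
   Context: The Calkin-Wilf tree of $\alpha$ is the infinite binary tree whose root is labeled $\alpha$ and in which every vertex labeled $x$ has a left child labeled $\frac{x}{x+1}$ and a right child labeled $x+1$ (since $\alpha>0$, all labels are positive). Each vertex carries a triple $(\varepsilon,c,d)$ with $\varepsilon\in\{-1,1\}$, $c$ an integer, $d$ a positive integer dividing $N-c^2$, and label equal to $\frac{\varepsilon\sqrt N+c}{d}$, defined as follows. The root has triple $(1,p,q)$. If a vertex has triple $(\varepsilon,c,d)$, its right child has triple $(\varepsilon,c+d,d)$; its left child has triple $\left(-\varepsilon,\frac{N-c^2}{d}-c,\frac{N-(c+d)^2}{d}\right)$ if $N-(c+d)^2>0$, and $\left(\varepsilon,c-\frac{N-c^2}{d},\frac{(c+d)^2-N}{d}\right)$ otherwise. The left-positive path (LPP) of $\alpha$ is the infinite descending path which starts at the root and which, from each vertex, goes to the left child if the value of $\varepsilon$ for that left child is $1$, and to the right child otherwise. $x_n$ denotes the label of the $n$-th vertex of the LPP, with $x_0=\alpha$. An irrationality path is a path descending from the root of the Calkin-Wilf tree of $\alpha$ that contains the same number at two different vertices. *)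

theory Defs
  imports Complex_Main
begin

datatype direction = Go_Left | Go_Right

text \<open>A vertex of the infinite binary tree is the list of steps that lead to it from the root,
  with the last step at the head; so the children of \<open>v\<close> are \<open>Go_Left # v\<close> and \<open>Go_Right # v\<close>.\<close>

type_synonym vertex = "direction list"

primrec cw_label :: "real \<Rightarrow> vertex \<Rightarrow> real" where
  "cw_label \<alpha> [] = \<alpha>"
| "cw_label \<alpha> (s # v) =
     (case s of
        Go_Left \<Rightarrow> cw_label \<alpha> v / (cw_label \<alpha> v + 1)
      | Go_Right \<Rightarrow> cw_label \<alpha> v + 1)"

text \<open>All divisions below are exact at the triples that occur in the tree;
  see \<open>cw_triple_invariant\<close> below.\<close>

fun left_triple :: "int \<Rightarrow> int \<times> int \<times> int \<Rightarrow> int \<times> int \<times> int" where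
  "left_triple N (\<epsilon>, c, d) =
     (if N - (c + d)\<^sup>2 > 0
      then (- \<epsilon>, (N - c\<^sup>2) div d - c, (N - (c + d)\<^sup>2) div d)
      else (\<epsilon>, c - (N - c\<^sup>2) div d, ((c + d)\<^sup>2 - N) div d))"

fun right_triple :: "int \<times> int \<times> int \<Rightarrow> int \<times> int \<times> int" where
  "right_triple (\<epsilon>, c, d) = (\<epsilon>, c + d, d)"

primrec cw_triple :: "int \<Rightarrow> int \<Rightarrow> int \<Rightarrow> vertex \<Rightarrow> int \<times> int \<times> int" where
  "cw_triple N p q [] = (1, p, q)"
| "cw_triple N p q (s # v) =
     (case s of
        Go_Left \<Rightarrow> left_triple N (cw_triple N p q v)
      | Go_Right \<Rightarrow> right_triple (cw_triple N p q v))"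

primrec lpp :: "int \<Rightarrow> int \<Rightarrow> int \<Rightarrow> nat \<Rightarrow> vertex" where
  "lpp N p q 0 = []"
| "lpp N p q (Suc n) =
     (if fst (cw_triple N p q (Go_Left # lpp N p q n)) = 1
      then Go_Left # lpp N p q n
      else Go_Right # lpp N p q n)"

text \<open>A path, finite or infinite, is represented by the set of its vertices.\<close>

definition descending_path :: "vertex set \<Rightarrow> bool" where
  "descending_path P \<longleftrightarrow>
     [] \<in> P \<and>
     (\<forall>s v. s # v \<in> P \<longrightarrow> v \<in> P) \<and>
     (\<forall>s t v. s # v \<in> P \<longrightarrow> t # v \<in> P \<longrightarrow> s = t)"

definition irrationality_path :: "real \<Rightarrow> vertex set \<Rightarrow> bool" where
  "irrationality_path \<alpha> P \<longleftrightarrow>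
     descending_path P \<and> (\<exists>u\<in>P. \<exists>v\<in>P. u \<noteq> v \<and> cw_label \<alpha> u = cw_label \<alpha> v)"

lemma cw_triple_invariant:
  fixes N p q :: int
  assumes N: "N > 0" "\<nexists>k::int. N = k\<^sup>2" and q: "q > 0" "q dvd N - p\<^sup>2"
    and t: "cw_triple N p q v = (\<epsilon>, c, d)"
  shows "\<epsilon> \<in> {-1, 1} \<and> d > 0 \<and> d dvd N - c\<^sup>2 \<and>
    cw_label ((sqrt (of_int N) + of_int p) / of_int q) v
      = (of_int \<epsilon> * sqrt (of_int N) + of_int c) / of_int d"
  using t
proof (induction v arbitrary: \<epsilon> c d)
  case Nil
  then show ?case using q by auto
next
  case (Cons s v)
  let ?\<alpha> = "(sqrt (of_int N) + of_int p) / of_int q :: real"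
  obtain \<epsilon>' c' d' where t': "cw_triple N p q v = (\<epsilon>', c', d')" by (metis prod_cases3)
  note IH = Cons.IH[OF t']
  have e': "\<epsilon>' \<in> {-1, 1}" and d': "d' > 0" and dv': "d' dvd N - c'\<^sup>2"
    and lab: "cw_label ?\<alpha> v = (of_int \<epsilon>' * sqrt (of_int N) + of_int c') / of_int d'"
    using IH by blast+
  obtain e where e: "N - c'\<^sup>2 = d' * e" using dv' by (elim dvdE)
  show ?case
  proof (cases s)
    case Go_Right
    then have tr: "\<epsilon> = \<epsilon>'" "c = c' + d'" "d = d'" using Cons.prems t' by auto
    have "N - (c' + d')\<^sup>2 = d' * (e - 2 * c' - d')"
      using e by (simp add: power2_eq_square algebra_simps)
    then have "d' dvd N - (c' + d')\<^sup>2" by simp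
    then show ?thesis using Go_Right tr e' d' lab by (simp add: field_simps)
  next
    case Go_Left
    let ?f = "e - 2 * c' - d'"
    have f: "N - (c' + d')\<^sup>2 = d' * ?f"
      using e by (simp add: power2_eq_square algebra_simps)
    then have f2: "(c' + d')\<^sup>2 - N = d' * (- ?f)" by (simp add: algebra_simps)
    have "?f \<noteq> 0" using N(2) f by (metis eq_iff_diff_eq_0 mult_zero_right)
    define s where "s = sqrt (of_int N)"
    have ss: "s * s = of_int N" unfolding s_def using N(1) by simp
    have ees: "of_int \<epsilon>' * of_int \<epsilon>' = (1::real)" using e' by auto
    have fr: "of_int N - (of_int c' + of_int d')\<^sup>2 = of_int d' * (of_int ?f :: real)"
      using f by (metis of_int_add of_int_diff of_int_mult of_int_power)
    have er: "of_int N - (of_int c')\<^sup>2 = of_int d' * (of_int e :: real)"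
      using e by (metis of_int_diff of_int_mult of_int_power)
    let ?A = "of_int \<epsilon>' * s + of_int c' :: real"
    let ?B = "of_int \<epsilon>' * s - of_int c' - of_int d' :: real"
    have esq: "(of_int \<epsilon>' * s) * (of_int \<epsilon>' * s) = of_int N"
      using ss ees by (metis mult.assoc mult.commute mult.right_neutral)
    have AB: "(?A + of_int d') * ?B = of_int d' * of_int ?f"
      using esq fr by (simp add: power2_eq_square algebra_simps)
    have AB2: "?A * ?B = of_int d' * (- of_int \<epsilon>' * s + of_int (e - c'))"
      using esq er by (simp add: power2_eq_square algebra_simps)
    have nz: "?A + of_int d' \<noteq> 0" "?B \<noteq> 0"
      using AB \<open>?f \<noteq> 0\<close> d' by auto
    have "cw_label ?\<alpha> (Go_Left # v) = ?A / (?A + of_int d')"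
    proof -
      have l: "cw_label ?\<alpha> v = ?A / of_int d'" using lab by (simp add: s_def)
      have "cw_label ?\<alpha> v + 1 = (?A + of_int d') / of_int d'"
        unfolding l using d' by (simp add: add_divide_distrib)
      then show ?thesis using l d' by simp
    qed
    also have "\<dots> = (?A * ?B) / ((?A + of_int d') * ?B)" using nz by simp
    also have "\<dots> = (- of_int \<epsilon>' * s + of_int (e - c')) / of_int ?f"
      unfolding AB AB2 using d' by simp
    finally have L: "cw_label ?\<alpha> (Go_Left # v)
        = (- of_int \<epsilon>' * s + of_int (e - c')) / of_int ?f" .
    have "N - (e - c')\<^sup>2 = ?f * (- e)"
      using e by (simp add: power2_eq_square algebra_simps)
    then have dv: "?f dvd N - (e - c')\<^sup>2" by (metis dvd_triv_left)
    have q1: "(N - c'\<^sup>2) div d' = e" "(N - (c' + d')\<^sup>2) div d' = ?f"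
      "((c' + d')\<^sup>2 - N) div d' = - ?f"
      unfolding e f f2 using d' by simp_all
    show ?thesis
    proof (cases "N - (c' + d')\<^sup>2 > 0")
      case True
      then have "?f > 0" unfolding f using d' by (simp add: zero_less_mult_iff)
      have "\<epsilon> = - \<epsilon>'" "c = e - c'" "d = ?f"
        using Cons.prems t' Go_Left True q1 by auto
      then show ?thesis using L e' dv \<open>?f > 0\<close> Go_Left by (auto simp: s_def)
    next
      case False
      then have "?f < 0" unfolding f using d' \<open>?f \<noteq> 0\<close> by (simp add: zero_less_mult_iff)
      have tr: "\<epsilon> = \<epsilon>'" "c = - (e - c')" "d = - ?f"
        using Cons.prems t' Go_Left False q1 by auto
      have "(- of_int \<epsilon>' * s + of_int (e - c')) / of_int ?f
          = - (- of_int \<epsilon>' * s + of_int (e - c')) / of_int (- ?f)"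
        unfolding of_int_minus by (metis minus_divide_divide)
      then have "cw_label ?\<alpha> (Go_Left # v) = (of_int \<epsilon> * s + of_int c) / of_int d"
        unfolding L tr by simp
      moreover have "d dvd N - c\<^sup>2"
        unfolding tr power2_minus minus_dvd_iff by (rule dv)
      moreover have "d > 0" using tr \<open>?f < 0\<close> by simp
      ultimately show ?thesis using tr(1) e' Go_Left s_def by metis
    qed
  qed
qed

end

(* On the left-positive path epsilon stays 1, and so does the condition c^2 < N: a right step is
   taken only if (c + d)^2 < N, and after a left step N - c'^2 = d' * ((N - c^2) / d) > 0.
   Together with d dvd N - c^2 this leaves only finitely many triples, so one of them recurs. *)

theory Submission
  imports Defs
begin

text \<open>A divisor of the positive number \<open>N - c^2\<close> is at most \<open>N\<close>, and
  an integer satisfies |c| \<le> c^2 < \<open>N\<close>; so all these triples lie in a finite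
  box.\<close>

lemma finite_reduced_triples:
  "finite {(1 :: int, c, d) | c d. d > (0 :: int) \<and> c\<^sup>2 < N \<and> d dvd N - c\<^sup>2}"
proof (rule finite_subset)
  have "\<bar>c\<bar> \<le> N \<and> d \<le> N"
    if "d > 0" "c\<^sup>2 < N" "d dvd N - c\<^sup>2" for c d :: int
  proof -
    have "d \<le> N - c\<^sup>2" using that by (simp add: zdvd_imp_le)
    moreover have "\<bar>c\<bar> \<le> c\<^sup>2"
      using self_le_power[of "\<bar>c\<bar>" 2] by (cases "c = 0") simp_all
    ultimately show ?thesis using that(2) zero_le_power2[of c] by linarith
  qed
  then show "{(1 :: int, c, d) | c d. d > (0 :: int) \<and> c\<^sup>2 < N \<and> d dvd N - c\<^sup>2}
    \<subseteq> {1} \<times> {- N..N} \<times> {0..N}"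
    by (fastforce simp: abs_le_iff)
qed simp

text \<open>The conditional in \<open>t\<close> is one step of the path, read on triples alone. From
  sign 1 the left child keeps sign 1 exactly when (c + d)^2 \<ge> N, so the path turns left
  precisely when a right step would break the bound on \<open>c\<close>.\<close>

lemma lpp_step_reduced:
  fixes N c d :: int
  assumes N: "\<nexists>k::int. N = k\<^sup>2"
    and d: "d > 0" and c: "c\<^sup>2 < N" and dvd: "d dvd N - c\<^sup>2"
    and t: "(if fst (left_triple N (1, c, d)) = 1 then left_triple N (1, c, d)
             else right_triple (1, c, d)) = (\<epsilon>, c', d')"
  shows "\<epsilon> = 1 \<and> d' > 0 \<and> c'\<^sup>2 < N \<and> d' dvd N - c'\<^sup>2"
proof -
  obtain e where e: "N - c\<^sup>2 = d * e" using dvd by (elim dvdE)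
  show ?thesis
  proof (cases "N - (c + d)\<^sup>2 > 0")
    case True
    then have [simp]: "\<epsilon> = 1" "c' = c + d" "d' = d" using t by simp_all
    have "N - (c + d)\<^sup>2 = d * (e - 2 * c - d)"
      using e by (simp add: power2_eq_square algebra_simps)
    then show ?thesis using True d by simp
  next
    case False
    \<comment> \<open>The new denominator ((c + d)^2 - N) / d, rewritten with N = c^2 + d *
      e.\<close>
    define f where "f = 2 * c + d - e"
    have f: "(c + d)\<^sup>2 - N = d * f"
      using e by (simp add: f_def power2_eq_square algebra_simps)
    have "(N - c\<^sup>2) div d = e" "((c + d)\<^sup>2 - N) div d = f"
      unfolding e f using d by simp_all
    then have tr: "\<epsilon> = 1" "c' = c - e" "d' = f" using t False by simp_all
    \<comment> \<open>\<open>False\<close> only gives (c + d)^2 \<ge> N; equality would make the new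
      denominator zero, and \<open>N\<close> being a nonsquare excludes it.\<close>
    have "(c + d)\<^sup>2 \<noteq> N" using N by blast
    then have "d * f > 0" using False f by linarith
    then have "f > 0" using d by (simp add: zero_less_mult_iff)
    have "e > 0" using c d e by (metis diff_gt_0_iff_gt zero_less_mult_pos)
    \<comment> \<open>This factorization gives both remaining claims: \<open>f\<close> divides the
      left side, and the left side is positive because \<open>e\<close> and \<open>f\<close>
      are.\<close>
    have id: "N - (c - e)\<^sup>2 = f * e"
      using e by (simp add: f_def power2_eq_square algebra_simps)
    have "f * e > 0" using \<open>f > 0\<close> \<open>e > 0\<close> by simp
    then show ?thesis unfolding tr using id \<open>f > 0\<close> by simp
  qed
qed

lemma lpp_reduced:
  fixes N p q :: int
  assumes "\<nexists>k::int. N = k\<^sup>2" "p\<^sup>2 < N" "q > 0" "q dvd N - p\<^sup>2"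
  shows "\<exists>c d. cw_triple N p q (lpp N p q n) = (1, c, d) \<and> d > 0 \<and> c\<^sup>2 < N \<and> d dvd N - c\<^sup>2"
proof (induction n)
  case 0
  then show ?case using assms by simp
next
  case (Suc n)
  then obtain c d where cd: "cw_triple N p q (lpp N p q n) = (1, c, d)"
    "d > 0" "c\<^sup>2 < N" "d dvd N - c\<^sup>2" by blast
  have step: "cw_triple N p q (lpp N p q (Suc n)) =
    (if fst (left_triple N (1, c, d)) = 1 then left_triple N (1, c, d)
     else right_triple (1, c, d))"
    by (simp add: cd(1) del: left_triple.simps right_triple.simps)
  obtain \<epsilon> c' d' where "cw_triple N p q (lpp N p q (Suc n)) = (\<epsilon>, c', d')"
    by (metis prod_cases3)
  with lpp_step_reduced[OF assms(1) cd(2-4)] step show ?case by metis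
qed

lemma length_lpp [simp]: "length (lpp N p q n) = n"
  by (induction n) auto

text \<open>The path has exactly one vertex at each depth, so a vertex on it is recovered from its
  length. Closure under parents and uniqueness of the child both follow.\<close>

lemma descending_path_range_lpp: "descending_path (range (lpp N p q))"
proof -
  have parent: "v = lpp N p q (length v) \<and> s # v = lpp N p q (Suc (length v))"
    if child: "s # v \<in> range (lpp N p q)" for s v
  proof -
    obtain n where n: "s # v = lpp N p q n" using child by blast
    then have "n = Suc (length v)" by (metis length_Cons length_lpp)
    with n show ?thesis by (auto split: if_splits)
  qed
  have "[] \<in> range (lpp N p q)" by (metis lpp.simps(1) rangeI)
  with parent show ?thesis
    unfolding descending_path_def by (metis list.inject rangeI)
qed

text \<open>The lowest-terms argument: N * n^2 = m^2 with \<open>m\<close>, \<open>n\<close> coprime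
  makes n^2 a unit, so N = m^2. Irrationality of \<open>\<alpha>\<close> is drawn from this, not
  from the repeated label.\<close>

lemma sqrt_nonsquare_irrational:
  fixes N :: int
  assumes "N > 0" "\<nexists>k::int. N = k\<^sup>2"
  shows "sqrt (of_int N) \<notin> \<rat>"
proof
  assume "sqrt (of_int N) \<in> \<rat>"
  then obtain m n :: nat where mn: "n \<noteq> 0" "\<bar>sqrt (of_int N)\<bar> = real m / real n" "coprime m n"
    by (rule Rats_abs_nat_div_natE)
  have "of_int N = (real m / real n)\<^sup>2"
    using assms(1) mn(2) by (metis of_int_0_le_iff order_less_imp_le power2_abs real_sqrt_pow2)
  then have "of_int N * (real n)\<^sup>2 = (real m)\<^sup>2"
    using mn(1) by (simp add: power_divide)
  then have eq: "N * (int n)\<^sup>2 = (int m)\<^sup>2"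
    by (metis of_int_eq_iff of_int_mult of_int_of_nat_eq of_int_power)
  then have "(int n)\<^sup>2 dvd (int m)\<^sup>2" by (metis dvd_triv_right)
  moreover have "coprime ((int n)\<^sup>2) ((int m)\<^sup>2)"
    using mn(3) by (simp add: coprime_commute)
  ultimately have "is_unit ((int n)\<^sup>2)" by (metis coprime_absorb_left)
  then have "(int n)\<^sup>2 = 1" by simp
  with eq have "N = (int m)\<^sup>2" by simp
  with assms(2) show False by blast
qed

theorem corollary1:
  fixes N p q :: int and \<alpha> :: real and x :: "nat \<Rightarrow> real"
  assumes "N > 0"
    and "\<nexists>k::int. N = k\<^sup>2"
    and "p\<^sup>2 < N"
    and "q > 0"
    and "q dvd N - p\<^sup>2"
    and "\<alpha> = (sqrt (of_int N) + of_int p) / of_int q"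
    and "\<And>n. x n = cw_label \<alpha> (lpp N p q n)"
  shows "irrationality_path \<alpha> (range (lpp N p q))
    \<and> (\<exists>n m. n < m \<and> x n = x m)
    \<and> \<alpha> \<notin> \<rat>"
proof -
  let ?t = "\<lambda>n. cw_triple N p q (lpp N p q n)"
  have "range ?t \<subseteq> {(1, c, d) | c d. d > 0 \<and> c\<^sup>2 < N \<and> d dvd N - c\<^sup>2}"
    using lpp_reduced[OF assms(2-5)] by blast
  then have "finite (range ?t)"
    using finite_reduced_triples finite_subset by blast
  \<comment> \<open>Pigeonhole: infinitely many indices, finitely many triples.\<close>
  then have "\<not> inj ?t"
    using finite_imageD infinite_UNIV_nat by blast
  then obtain n m where nm: "n < m" "?t n = ?t m"
    by (metis injI linorder_neqE_nat)
  obtain \<epsilon> c d where t: "?t n = (\<epsilon>, c, d)" by (metis prod_cases3)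
  \<comment> \<open>A label is determined by its triple, so a repeated triple forces a repeated
    label.\<close>
  note label = cw_triple_invariant[OF assms(1,2,4,5), folded assms(6)]
  have "x n = x m"
    unfolding assms(7) using label[OF t] label[OF t[unfolded nm(2)]] by simp
  \<comment> \<open>Equal labels must sit at different vertices; these two differ in depth.\<close>
  have "lpp N p q n \<noteq> lpp N p q m"
    using nm(1) by (metis length_lpp less_irrefl)
  then have "irrationality_path \<alpha> (range (lpp N p q))"
    unfolding irrationality_path_def
    using descending_path_range_lpp \<open>x n = x m\<close> assms(7) by (metis rangeI)
  moreover have "\<alpha> \<notin> \<rat>"
  proof
    assume "\<alpha> \<in> \<rat>"
    then have "\<alpha> * of_int q - of_int p \<in> \<rat>" by simp
    moreover have "\<alpha> * of_int q - of_int p = sqrt (of_int N)"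
      using assms(4,6) by simp
    ultimately show False using sqrt_nonsquare_irrational[OF assms(1,2)] by simp
  qed
  ultimately show ?thesis using nm(1) \<open>x n = x m\<close> by blast
qed

end
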